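(* Let $k$ be a field, $A=k[x,y]$ the polynomial ring in two variables, and for each integer $n\ge1$ let $B_n=A\big[(x-1)/(x^ny-1)\big]\subset k(x,y)$. If $m,n\ge 1$ and $B_m\cong B_n$ as $k$-algebras, then $m=n$. *)

theory Defs
  imports "HOL-Computational_Algebra.Polynomial" "HOL-Computational_Algebra.Fraction_Field"
begin

text \<open>The polynomial ring A = k[x,y] is modelled as 'k poly poly: outer variable y,
  inner variable x. Its fraction field k(x,y) is ('k poly poly) fract.\<close>

definition varX :: "'k::field poly poly" where
  "varX = [:[:0, 1:]:]"

definition varY :: "'k::field poly poly" where
  "varY = [:0, 1:]"

definition embA :: "'k::field poly poly \<Rightarrow> ('k poly poly) fract" where
  "embA a = Fract a 1"

definition scalar :: "'k::field \<Rightarrow> ('k poly poly) fract" where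
  "scalar c = embA [:[:c:]:]"

definition tgen :: "nat \<Rightarrow> ('k::field poly poly) fract" where
  "tgen n = Fract (varX - 1) (varX ^ n * varY - 1)"

definition Bring :: "nat \<Rightarrow> ('k::field poly poly) fract set" where
  "Bring n = {poly (map_poly embA q) (tgen n) | q. True}"

definition k_alg_iso ::
  "(('k::field poly poly) fract \<Rightarrow> ('k poly poly) fract) \<Rightarrow> ('k poly poly) fract set \<Rightarrow> ('k poly poly) fract set \<Rightarrow> bool" where
  "k_alg_iso f R S \<longleftrightarrow> bij_betw f R S \<and> f 1 = 1
     \<and> (\<forall>a\<in>R. \<forall>b\<in>R. f (a + b) = f a + f b)
     \<and> (\<forall>a\<in>R. \<forall>b\<in>R. f (a * b) = f a * f b)
     \<and> (\<forall>c. \<forall>a\<in>R. f (scalar c * a) = scalar c * f a)"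

end

theory Submission
  imports Defs "HOL-Library.Poly_Mapping" "HOL-Library.Product_Lexorder" "HOL-Library.Product_Plus"
begin

text \<open>Put \<open>s = x\<^sup>n y - 1\<close> and \<open>t = (x - 1)/s\<close>. Since \<open>y = (1 + s)/x\<^sup>n\<close>, the ring \<open>B\<^sub>n = k[x, y, t]\<close>
  lies in the Laurent polynomial ring \<open>k[x, 1/x, s, 1/s]\<close>. Let \<open>[f, g]\<close> be the Jacobian of \<open>f\<close>, \<open>g\<close>
  with respect to the logarithmic form \<open>dx/x \<and> ds/s\<close>; then \<open>x\<^bsup>n-1\<^esup> [f, g]\<close> lies in \<open>B\<^sub>n\<close> for
  \<open>f, g\<close> in \<open>B\<^sub>n\<close>.

  Let \<open>X, Y, T\<close> in \<open>B\<^sub>n\<close> be the images of the generators of \<open>B\<^sub>m\<close>. They satisfy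
  \<open>T (X\<^sup>m Y - 1) = X - 1\<close>, and since this surface is smooth, differentiating the relation gives
  \<open>[X, T] = - u X\<^sup>m T\<close> with \<open>x\<^bsup>n-1\<^esup> u\<close> in \<open>B\<^sub>n\<close> and \<open>u \<noteq> 0\<close>. The logarithmic derivations do not
  enlarge supports, so comparing extremal exponents in \<open>[X, T] = (- u X\<^bsup>m-1\<^esup>) X T\<close> forces
  \<open>u X\<^bsup>m-1\<^esup>\<close> to be a nonzero constant. Hence the nonunit \<open>X\<close> has a power \<open>X\<^bsup>m-1\<^esup>\<close> dividing
  \<open>x\<^bsup>n-1\<^esup>\<close> in \<open>B\<^sub>n\<close>; as \<open>x\<close> is prime there, \<open>m \<le> n\<close>, and equality follows by symmetry.\<close>

subsection \<open>Extremal exponents and derivations of group algebras\<close>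

text \<open>Under the lexicographic order, pairs of integer exponents form a totally ordered group,
  so a nonzero Laurent polynomial has a largest and a smallest exponent.\<close>

instance prod :: (linordered_ab_group_add, linordered_ab_group_add) linordered_ab_group_add
  by intro_classes (auto simp: less_eq_prod_def)

section \<open>Evaluating polynomials after a map on coefficients\<close>

lemma poly_map_poly_pCons:
  assumes "\<phi> 0 = 0"
  shows "poly (map_poly \<phi> (pCons a p)) z = \<phi> a + z * poly (map_poly \<phi> p) z"
  using assms by (cases "pCons a p = 0") (auto simp: map_poly_pCons)

lemma poly_map_poly_add:
  fixes \<phi> :: "'a::comm_ring_1 \<Rightarrow> 'b::comm_ring_1"
  assumes "\<phi> 0 = 0" and "\<And>a b. \<phi> (a + b) = \<phi> a + \<phi> b"
  shows "poly (map_poly \<phi> (p + q)) z = poly (map_poly \<phi> p) z + poly (map_poly \<phi> q) z"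
proof (induction p arbitrary: q)
  case (pCons a p)
  show ?case
    by (cases q) (use assms pCons in \<open>auto simp: poly_map_poly_pCons algebra_simps\<close>)
qed auto

lemma poly_map_poly_mult:
  fixes \<phi> :: "'a::comm_ring_1 \<Rightarrow> 'b::comm_ring_1"
  assumes "\<phi> 0 = 0" and "\<And>a b. \<phi> (a + b) = \<phi> a + \<phi> b" and "\<And>a b. \<phi> (a * b) = \<phi> a * \<phi> b"
  shows "poly (map_poly \<phi> (p * q)) z = poly (map_poly \<phi> p) z * poly (map_poly \<phi> q) z"
proof (induction p)
  case (pCons a p)
  have "poly (map_poly \<phi> (smult a q)) z = \<phi> a * poly (map_poly \<phi> q) z"
    by (induction q) (use assms in \<open>auto simp: poly_map_poly_pCons algebra_simps\<close>)
  then show ?case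
    using pCons assms by (simp add: poly_map_poly_pCons poly_map_poly_add algebra_simps)
qed auto

section \<open>Supports of products in group algebras\<close>

lemma poly_mapping_induct_add [case_names zero single add]:
  assumes "P 0" and "\<And>k c. P (Poly_Mapping.single k c)"
    and "\<And>f g. P f \<Longrightarrow> P g \<Longrightarrow> P (f + g)"
  shows "P (f :: 'a \<Rightarrow>\<^sub>0 'b::comm_monoid_add)"
proof (induction f rule: update_induct)
  case (update f k c)
  have "Poly_Mapping.update k c f = f + Poly_Mapping.single k c"
    using update(1) by (intro poly_mapping_eqI)
      (auto simp: lookup_update lookup_add lookup_single in_keys_iff when_def)
  then show ?case using assms update by metis
qed (rule assms)

lemma lookup_single_times:
  fixes f :: "'a::ab_group_add \<Rightarrow>\<^sub>0 'b::comm_ring_1"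
  shows "Poly_Mapping.lookup (Poly_Mapping.single k c * f) j = c * Poly_Mapping.lookup f (j - k)"
proof (induction f rule: poly_mapping_induct_add)
  case (single l d)
  have "k + l = j \<longleftrightarrow> l = j - k" by (auto simp: algebra_simps)
  then show ?case by (simp add: mult_single lookup_single when_def)
qed (auto simp: algebra_simps lookup_add)

text \<open>Split off the term of \<open>f\<close> at \<open>a\<close>: by the assumption the
  remainder \<open>f'\<close> times \<open>g\<close> has no term at \<open>a + b\<close>, and
  multiplying by a single monomial only shifts \<open>g\<close>.\<close>

lemma lookup_times_unique:
  fixes f g :: "'a::ab_group_add \<Rightarrow>\<^sub>0 'b::comm_ring_1"
  assumes "\<And>i j. i \<in> Poly_Mapping.keys f \<Longrightarrow> j \<in> Poly_Mapping.keys g \<Longrightarrow> i + j = a + b \<Longrightarrow> i = a"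
  shows "Poly_Mapping.lookup (f * g) (a + b) = Poly_Mapping.lookup f a * Poly_Mapping.lookup g b"
proof -
  define f' where "f' = f - Poly_Mapping.single a (Poly_Mapping.lookup f a)"
  have f': "i \<in> Poly_Mapping.keys f' \<Longrightarrow> i \<in> Poly_Mapping.keys f \<and> i \<noteq> a" for i
    by (auto simp: f'_def in_keys_iff lookup_minus lookup_single when_def split: if_splits)
  have "a + b \<notin> Poly_Mapping.keys (f' * g)"
  proof
    assume "a + b \<in> Poly_Mapping.keys (f' * g)"
    then obtain i j where "i \<in> Poly_Mapping.keys f'" "j \<in> Poly_Mapping.keys g" "a + b = i + j"
      using keys_mult[of f' g] by blast
    then show False using assms f' by metis
  qed
  moreover have "f * g = f' * g + Poly_Mapping.single a (Poly_Mapping.lookup f a) * g"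
    by (simp add: f'_def algebra_simps)
  ultimately show ?thesis
    by (simp add: lookup_add lookup_single_times in_keys_iff)
qed

text \<open>Addition is strictly monotone, so a single pair of exponents reaches the largest sum,
  and the product of the two leading coefficients does not vanish in a domain.\<close>

lemma Max_keys_times:
  fixes f g :: "'a::linordered_ab_group_add \<Rightarrow>\<^sub>0 'b::idom"
  assumes "f \<noteq> 0" and "g \<noteq> 0"
  shows "Max (Poly_Mapping.keys f) + Max (Poly_Mapping.keys g) \<in> Poly_Mapping.keys (f * g)"
proof -
  have "i = Max (Poly_Mapping.keys f)"
    if "i \<in> Poly_Mapping.keys f" "j \<in> Poly_Mapping.keys g" "i + j = Max (Poly_Mapping.keys f) + Max (Poly_Mapping.keys g)" for i j
    using add_less_le_mono[of i "Max (Poly_Mapping.keys f)" j "Max (Poly_Mapping.keys g)"]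
      that Max_ge[OF finite_keys that(1)] Max_ge[OF finite_keys that(2)]
    by (metis less_irrefl order.not_eq_order_implies_strict)
  then have "Poly_Mapping.lookup (f * g) (Max (Poly_Mapping.keys f) + Max (Poly_Mapping.keys g))
      = Poly_Mapping.lookup f (Max (Poly_Mapping.keys f)) * Poly_Mapping.lookup g (Max (Poly_Mapping.keys g))"
    by (rule lookup_times_unique)
  moreover have "Max (Poly_Mapping.keys f) \<in> Poly_Mapping.keys f" "Max (Poly_Mapping.keys g) \<in> Poly_Mapping.keys g"
    using assms by (auto intro!: Max_in)
  ultimately show ?thesis by (simp add: in_keys_iff)
qed

lemma Min_keys_times:
  fixes f g :: "'a::linordered_ab_group_add \<Rightarrow>\<^sub>0 'b::idom"
  assumes "f \<noteq> 0" and "g \<noteq> 0"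
  shows "Min (Poly_Mapping.keys f) + Min (Poly_Mapping.keys g) \<in> Poly_Mapping.keys (f * g)"
proof -
  have "i = Min (Poly_Mapping.keys f)"
    if "i \<in> Poly_Mapping.keys f" "j \<in> Poly_Mapping.keys g" "i + j = Min (Poly_Mapping.keys f) + Min (Poly_Mapping.keys g)" for i j
    using add_less_le_mono[of "Min (Poly_Mapping.keys f)" i "Min (Poly_Mapping.keys g)" j]
      that Min_le[OF finite_keys that(1)] Min_le[OF finite_keys that(2)]
    by (metis less_irrefl order.not_eq_order_implies_strict)
  then have "Poly_Mapping.lookup (f * g) (Min (Poly_Mapping.keys f) + Min (Poly_Mapping.keys g))
      = Poly_Mapping.lookup f (Min (Poly_Mapping.keys f)) * Poly_Mapping.lookup g (Min (Poly_Mapping.keys g))"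
    by (rule lookup_times_unique)
  moreover have "Min (Poly_Mapping.keys f) \<in> Poly_Mapping.keys f" "Min (Poly_Mapping.keys g) \<in> Poly_Mapping.keys g"
    using assms by (auto intro!: Min_in)
  ultimately show ?thesis by (simp add: in_keys_iff)
qed

text \<open>A positive exponent in \<open>h\<close> would push the top exponent of
  \<open>h * f * g\<close> above every sum of exponents of \<open>f\<close> and \<open>g\<close>; a
  negative one would do the same at the bottom. The bracket satisfies such a support bound, which is
  how this lemma gets applied.\<close>

lemma keys_times_subset_imp_const:
  fixes f g h :: "'a::linordered_ab_group_add \<Rightarrow>\<^sub>0 'b::idom"
  assumes "f \<noteq> 0" and "g \<noteq> 0" and sub: "Poly_Mapping.keys (h * f * g) \<subseteq> {i + j | i j. i \<in> Poly_Mapping.keys f \<and> j \<in> Poly_Mapping.keys g}"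
  shows "h = Poly_Mapping.single 0 (Poly_Mapping.lookup h 0)"
proof (cases "h = 0")
  case False
  have fg: "f * g \<noteq> 0" using assms by simp
  have "Max (Poly_Mapping.keys h) + Max (Poly_Mapping.keys (f * g)) \<in> Poly_Mapping.keys (h * f * g)"
    using Max_keys_times[OF False fg] by (simp add: mult.assoc)
  then obtain i j where ij: "i \<in> Poly_Mapping.keys f" "j \<in> Poly_Mapping.keys g" "Max (Poly_Mapping.keys h) + Max (Poly_Mapping.keys (f * g)) = i + j"
    using sub by blast
  have "i + j \<le> Max (Poly_Mapping.keys f) + Max (Poly_Mapping.keys g)" using ij by (intro add_mono Max_ge) auto
  also have "\<dots> \<le> Max (Poly_Mapping.keys (f * g))"
    using Max_keys_times[OF assms(1,2)] by (intro Max_ge) auto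
  finally have "Max (Poly_Mapping.keys h) \<le> 0" using ij(3) by (metis add_le_same_cancel2)
  then have hi: "i \<le> 0" if "i \<in> Poly_Mapping.keys h" for i
    using Max_ge[OF finite_keys that] by (metis order_trans)
  have "Min (Poly_Mapping.keys h) + Min (Poly_Mapping.keys (f * g)) \<in> Poly_Mapping.keys (h * f * g)"
    using Min_keys_times[OF False fg] by (simp add: mult.assoc)
  then obtain i j where ij: "i \<in> Poly_Mapping.keys f" "j \<in> Poly_Mapping.keys g" "Min (Poly_Mapping.keys h) + Min (Poly_Mapping.keys (f * g)) = i + j"
    using sub by blast
  have "Min (Poly_Mapping.keys (f * g)) \<le> Min (Poly_Mapping.keys f) + Min (Poly_Mapping.keys g)"
    using Min_keys_times[OF assms(1,2)] by (intro Min_le) auto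
  also have "\<dots> \<le> i + j" using ij by (intro add_mono Min_le) auto
  finally have "0 \<le> Min (Poly_Mapping.keys h)" using ij(3) by (metis le_add_same_cancel2)
  then have lo: "0 \<le> i" if "i \<in> Poly_Mapping.keys h" for i
    using Min_le[OF finite_keys that] by (metis order_trans)
  have "i = 0" if "i \<in> Poly_Mapping.keys h" for i using hi lo that by (metis antisym)
  then show ?thesis
    by (intro poly_mapping_eqI) (auto simp: lookup_single when_def in_keys_iff)
qed simp

text \<open>For additive \<open>w\<close> this is a derivation. With exponents standing for
  \<open>x^i s^j\<close>, the weights \<open>fst\<close> and \<open>snd\<close> give
  \<open>x d/dx\<close> and \<open>s d/ds\<close>; rescaling coefficients creates no new
  exponents.\<close>

lift_definition weight_deriv ::
  "('a \<Rightarrow> int) \<Rightarrow> ('a \<Rightarrow>\<^sub>0 'b::comm_ring_1) \<Rightarrow> ('a \<Rightarrow>\<^sub>0 'b)"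
  is "\<lambda>w f k. of_int (w k) * f k"
  by (erule finite_subset[rotated]) auto

lemma weight_deriv_add: "weight_deriv w (f + g) = weight_deriv w f + weight_deriv w g"
  by transfer (auto simp: algebra_simps)

lemma weight_deriv_0 [simp]: "weight_deriv w 0 = 0"
  by transfer auto

lemma weight_deriv_diff: "weight_deriv w (f - g) = weight_deriv w f - weight_deriv w g"
  by transfer (auto simp: algebra_simps)

lemma weight_deriv_single:
  "weight_deriv w (Poly_Mapping.single k c) = Poly_Mapping.single k (of_int (w k) * c)"
  by transfer (auto simp: when_def)

lemma keys_weight_deriv: "Poly_Mapping.keys (weight_deriv w f) \<subseteq> Poly_Mapping.keys f"
  by (auto simp: in_keys_iff weight_deriv.rep_eq)

lemma weight_deriv_times:
  fixes f g :: "'a::ab_group_add \<Rightarrow>\<^sub>0 'b::comm_ring_1"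
  assumes w: "\<And>i j. w (i + j) = w i + w j"
  shows "weight_deriv w (f * g) = f * weight_deriv w g + weight_deriv w f * g"
proof (induction f rule: poly_mapping_induct_add)
  case (single k c)
  show ?case
  proof (induction g rule: poly_mapping_induct_add)
    case (single l d)
    show ?case
      by (simp add: mult_single weight_deriv_single w algebra_simps flip: single_add)
  qed (auto simp: algebra_simps weight_deriv_add)
qed (auto simp: algebra_simps weight_deriv_add)

subsection \<open>The logarithmic Jacobian bracket\<close>

text \<open>The key \<open>(i, j)\<close> stands for the monomial \<open>x^i s^j\<close>, where
  \<open>s = x^n y - 1\<close> replaces \<open>y\<close> as second coordinate.\<close>

type_synonym 'k laurent = "int \<times> int \<Rightarrow>\<^sub>0 'k"

definition mon :: "int \<Rightarrow> int \<Rightarrow> 'k::field laurent" where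
  "mon i j = Poly_Mapping.single (i, j) 1"

lemma mon_mult: "mon i j * mon k l = mon (i + k) (j + l)"
  by (simp add: mon_def mult_single)

lemma mon_0_0: "mon 0 0 = 1"
  by (simp add: mon_def flip: zero_prod_def)

lemma mon_power: "mon i j ^ d = mon (int d * i) (int d * j)"
  by (induction d) (auto simp: mon_0_0 mon_mult algebra_simps)

lemma mon_nonzero: "mon i j \<noteq> (0 :: 'k::field laurent)"
proof
  assume "mon i j = (0 :: 'k laurent)"
  then have "Poly_Mapping.lookup (mon i j :: 'k laurent) (i, j) = 0" by simp
  then show False by (simp add: mon_def)
qed

text \<open>The coefficient of \<open>df \<and> dg\<close> with respect to the logarithmic form \<open>dx/x \<and> ds/s\<close>.\<close>

definition bracket :: "'k::field laurent \<Rightarrow> 'k laurent \<Rightarrow> 'k laurent" where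
  "bracket f g = weight_deriv fst f * weight_deriv snd g - weight_deriv snd f * weight_deriv fst g"

lemma bracket_commute: "bracket f g = - bracket g f"
  by (simp add: bracket_def)

lemma bracket_add_right: "bracket h (f + g) = bracket h f + bracket h g"
  by (simp add: bracket_def weight_deriv_add algebra_simps)

lemma bracket_mult_right: "bracket h (f * g) = f * bracket h g + g * bracket h f"
  by (simp add: bracket_def weight_deriv_times algebra_simps)

lemma bracket_const_right: "bracket h (Poly_Mapping.single 0 c) = 0"
  by (simp add: bracket_def weight_deriv_single)

lemma weight_deriv_mon: "weight_deriv w (mon i j) = of_int (w (i, j)) * (mon i j :: 'k::field laurent)"
proof -
  have "of_int (w (i, j)) * (mon i j :: 'k laurent) = Poly_Mapping.single 0 (of_int (w (i, j))) * mon i j"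
    by simp
  also have "\<dots> = weight_deriv w (mon i j)"
    by (simp add: mon_def weight_deriv_single mult_single del: single_of_int)
  finally show ?thesis by simp
qed

lemma bracket_self: "bracket f f = 0"
  by (simp add: bracket_def algebra_simps)

lemma keys_bracket:
  "Poly_Mapping.keys (bracket f g) \<subseteq> {i + j | i j. i \<in> Poly_Mapping.keys f \<and> j \<in> Poly_Mapping.keys g}"
proof -
  have "Poly_Mapping.keys (weight_deriv w f * weight_deriv v g)
      \<subseteq> {i + j | i j. i \<in> Poly_Mapping.keys f \<and> j \<in> Poly_Mapping.keys g}" for w v
    using keys_mult[of "weight_deriv w f" "weight_deriv v g"] keys_weight_deriv[of w f]
      keys_weight_deriv[of v g] by blast
  then show ?thesis
    unfolding bracket_def
    by (smt (verit, ccfv_SIG) Un_iff keys_diff subset_iff)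
qed

lemma weight_deriv_1:
  assumes "\<And>i j. w (i + j) = w i + w j"
  shows "weight_deriv w (1 :: 'a::ab_group_add \<Rightarrow>\<^sub>0 'b::comm_ring_1) = 0"
  using assms[of 0 0] weight_deriv_single[of w 0 1] by simp

lemma weight_deriv_power_Suc:
  fixes f :: "'a::ab_group_add \<Rightarrow>\<^sub>0 'b::comm_ring_1"
  assumes "\<And>i j. w (i + j) = w i + w j"
  shows "weight_deriv w (f ^ Suc m) = of_nat (Suc m) * f ^ m * weight_deriv w f"
proof (induction m)
  case (Suc m)
  have "weight_deriv w (f ^ Suc (Suc m)) = f * weight_deriv w (f ^ Suc m) + weight_deriv w f * f ^ Suc m"
    by (subst power_Suc) (rule weight_deriv_times[OF assms])
  also have "\<dots> = of_nat (Suc (Suc m)) * f ^ Suc m * weight_deriv w f"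
    unfolding Suc.IH by (simp add: algebra_simps)
  finally show ?case .
qed simp

text \<open>Here \<open>(Q, P, S)\<close> will be the gradient of the surface relation and \<alpha>,
  \<beta>, \<gamma> the brackets \<open>[X, Y]\<close>, \<open>[X, T]\<close>,
  \<open>[Y, T]\<close>. The identity \<open>c * P - c * W * S - Q = 1\<close> expresses smoothness:
  the gradient generates the unit ideal. Pairing the brackets with these Bezout coefficients yields
  the multiplier \<open>u\<close>, without any division.\<close>

lemma proportional_to_unimodular:
  fixes P Q S :: "'a::comm_ring_1"
  assumes "P * \<alpha> = - (S * \<beta>)" and "Q * \<alpha> = S * \<gamma>" and "P * \<gamma> = - (Q * \<beta>)"
    and "Q = c * T - 1" and "P - W * S = T" and "u = - \<gamma> - c * \<beta> - c * W * \<alpha>"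
  shows "\<alpha> = u * S" and "\<beta> = - (u * P)" and "\<gamma> = u * Q"
proof -
  have one: "c * (P - W * S) - Q = 1"
    using assms(4,5) by simp
  have "u * S = - (S * \<gamma>) - c * (S * \<beta>) - c * W * S * \<alpha>"
    unfolding assms(6) by (simp add: algebra_simps)
  also have "\<dots> = - (Q * \<alpha>) + c * (P * \<alpha>) - c * W * S * \<alpha>"
    using assms(1,2) by simp
  also have "\<dots> = (c * (P - W * S) - Q) * \<alpha>" by (simp add: algebra_simps)
  finally show "\<alpha> = u * S" using one by simp
  have "- (u * P) = P * \<gamma> + c * P * \<beta> + c * W * (P * \<alpha>)"
    unfolding assms(6) by (simp add: algebra_simps)
  also have "\<dots> = - (Q * \<beta>) + c * P * \<beta> - c * W * (S * \<beta>)"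
    using assms(1,3) by simp
  also have "\<dots> = (c * (P - W * S) - Q) * \<beta>" by (simp add: algebra_simps)
  finally show "\<beta> = - (u * P)" using one by simp
  have "u * Q = - (Q * \<gamma>) - c * (Q * \<beta>) - c * W * (Q * \<alpha>)"
    unfolding assms(6) by (simp add: algebra_simps)
  also have "\<dots> = - (Q * \<gamma>) + c * (P * \<gamma>) - c * W * (S * \<gamma>)"
    using assms(2,3) by simp
  also have "\<dots> = (c * (P - W * S) - Q) * \<gamma>" by (simp add: algebra_simps)
  finally show "\<gamma> = u * Q" using one by simp
qed

text \<open>Both logarithmic derivations annihilate the relation, giving two vectors orthogonal to
  its gradient. The brackets are the 2x2 minors of these vectors, hence proportional to the
  gradient. The exponent of \<open>X\<close> in the relation is \<open>Suc m\<close>, so that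
  \<open>c\<close> needs no truncated subtraction.\<close>

lemma bracket_relations:
  fixes X Y T :: "'k::field laurent"
  assumes rel: "T * X ^ Suc m * Y + 1 = X + T"
  defines "c \<equiv> of_nat (Suc m) * X ^ m * Y"
  defines "u \<equiv> - bracket Y T - c * bracket X T - c * (T\<^sup>2 * (\<Sum>i<Suc m. X ^ i)) * bracket X Y"
  shows "bracket X Y = u * (X ^ Suc m * Y - 1)"
    and "bracket X T = - (u * (X ^ Suc m * T))"
    and "bracket Y T = u * (c * T - 1)"
proof -
  define S where "S = X ^ Suc m * Y - 1"
  define P where "P = X ^ Suc m * T"
  define Q where "Q = c * T - 1"
  \<comment> \<open>The chain rule: \<open>Q\<close>, \<open>P\<close>, \<open>S\<close> are the
    partial derivatives of \<open>T * X ^ Suc m * Y + 1 - X - T\<close> in \<open>X\<close>,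
    \<open>Y\<close>, \<open>T\<close>.\<close>
  have D: "Q * weight_deriv w X + P * weight_deriv w Y + S * weight_deriv w T = 0"
    if w: "\<And>i j. w (i + j) = w i + w j" for w :: "int \<times> int \<Rightarrow> int"
  proof -
    have "weight_deriv w (T * X ^ Suc m * Y + 1) = weight_deriv w (X + T)" by (simp only: rel)
    then have "T * X ^ Suc m * weight_deriv w Y
       + (T * (of_nat (Suc m) * X ^ m * weight_deriv w X) + weight_deriv w T * X ^ Suc m) * Y
       = weight_deriv w X + weight_deriv w T"
      by (simp only: weight_deriv_add weight_deriv_1[OF w] weight_deriv_times[OF w]
          weight_deriv_power_Suc[OF w] add_0_right)
    moreover have "(M * y * t - 1) * x' + z * t * y' + (z * y - 1) * t' = 0"
      if "t * z * y' + (t * (M * x') + t' * z) * y = x' + t'" for M x y z t x' y' t' :: "'k laurent"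
      using that by (simp add: algebra_simps eq_diff_eq)
    ultimately show ?thesis
      unfolding Q_def P_def S_def c_def by blast
  qed
  have D1: "Q * weight_deriv fst X + P * weight_deriv fst Y + S * weight_deriv fst T = 0"
    and D2: "Q * weight_deriv snd X + P * weight_deriv snd Y + S * weight_deriv snd T = 0"
    by (rule D; simp)+
  \<comment> \<open>Cramer's rule: cross-multiplying \<open>D1\<close> and \<open>D2\<close>
    eliminates one variable at a time.\<close>
  have 1: "P * bracket X Y = - (S * bracket X T)"
    and 2: "Q * bracket X Y = S * bracket Y T"
    and 3: "P * bracket Y T = - (Q * bracket X T)"
    unfolding bracket_def using D1 D2 by algebra+
  \<comment> \<open>Source of the Bezout coefficient: \<open>P - T = T * (X ^ Suc m - 1)\<close> is
    a multiple of \<open>S\<close>, because \<open>X - 1 = T * S\<close>.\<close>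
  have "X ^ Suc m - 1 = (X - 1) * (\<Sum>i<Suc m. X ^ i)"
    by (rule power_diff_1_eq)
  moreover have "T * S = X - 1"
    using rel by (simp add: S_def algebra_simps)
  ultimately have "T * (\<Sum>i<Suc m. X ^ i) * (T * S) = T * (X ^ Suc m - 1)"
    by (simp only: mult_ac)
  then have 4: "P - T\<^sup>2 * (\<Sum>i<Suc m. X ^ i) * S = T"
    by (simp add: P_def power2_eq_square algebra_simps del: power_Suc sum.lessThan_Suc)
  note * = proportional_to_unimodular[OF 1 2 3 Q_def 4 meta_eq_to_obj_eq[OF u_def]]
  show "bracket X Y = u * (X ^ Suc m * Y - 1)" "bracket X T = - (u * (X ^ Suc m * T))"
    "bracket Y T = u * (c * T - 1)"
    using * unfolding S_def P_def Q_def by blast+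
qed

subsection \<open>Embedding into Laurent polynomials\<close>

context
  fixes n :: nat
begin

definition evalX :: "'k::field poly \<Rightarrow> 'k laurent" where
  "evalX p = poly (map_poly (Poly_Mapping.single 0) p) (mon 1 0)"

definition evalA :: "'k::field poly poly \<Rightarrow> 'k laurent" where
  "evalA a = poly (map_poly evalX a) (mon (- int n) 0 * (1 + mon 0 1))"

lemma evalX_add: "evalX (p + q) = evalX p + evalX q"
  unfolding evalX_def by (intro poly_map_poly_add) (auto simp: single_add)

lemma evalX_0 [simp]: "evalX 0 = 0"
  by (simp add: evalX_def)

lemma evalX_mult: "evalX (p * q) = evalX p * evalX q"
  unfolding evalX_def by (intro poly_map_poly_mult) (auto simp: single_add mult_single)

lemma evalX_pCons: "evalX (pCons c p) = Poly_Mapping.single 0 c + mon 1 0 * evalX p"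
  by (simp add: evalX_def poly_map_poly_pCons)

lemma evalA_0 [simp]: "evalA 0 = 0"
  by (simp add: evalA_def)

lemma evalA_add: "evalA (p + q) = evalA p + evalA q"
  unfolding evalA_def by (intro poly_map_poly_add) (auto simp: evalX_add)

lemma evalA_mult: "evalA (p * q) = evalA p * evalA q"
  unfolding evalA_def by (intro poly_map_poly_mult) (auto simp: evalX_add evalX_mult)

lemma evalA_pCons: "evalA (pCons c p) = evalX c + mon (- int n) 0 * (1 + mon 0 1) * evalA p"
  by (simp add: evalA_def poly_map_poly_pCons)

lemma evalA_const: "evalA [:[:c:]:] = Poly_Mapping.single 0 c"
  by (simp add: evalA_pCons evalX_pCons)

lemma evalA_1 [simp]: "evalA 1 = 1"
  using evalA_const[of 1] by (simp add: one_pCons)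

lemma evalA_minus: "evalA (- p) = - evalA p"
  using evalA_add[of p "- p"] by (simp add: eq_neg_iff_add_eq_0 add.commute)

lemma evalA_diff: "evalA (p - q) = evalA p - evalA q"
  using evalA_add[of p "- q"] by (simp add: evalA_minus)

lemma evalA_power: "evalA (p ^ d) = evalA p ^ d"
  by (induction d) (auto simp: evalA_mult)

lemma evalA_varX: "evalA varX = mon 1 0"
  by (simp add: varX_def evalA_pCons evalX_pCons)

lemma evalA_varY: "evalA varY = mon (- int n) 0 * (1 + mon 0 1)"
proof -
  have "evalX [:1:] = (1 :: 'a laurent)" by (simp add: evalX_pCons)
  then show ?thesis by (simp add: varY_def evalA_pCons one_pCons)
qed

lemma evalA_denominator: "evalA (varX ^ n * varY - 1) = (mon 0 1 :: 'k::field laurent)"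
proof -
  have "mon (int n) 0 * (mon (- int n) 0 * (1 + mon 0 1)) = (1 + mon 0 1 :: 'k laurent)"
    by (simp add: mon_mult mon_0_0 flip: mult.assoc)
  note * = this
  show ?thesis
    by (simp add: evalA_diff evalA_mult evalA_power evalA_varX evalA_varY mon_power *)
qed

lemma lookup_mon_times: "Poly_Mapping.lookup (mon i j * f) (a, b) = Poly_Mapping.lookup f (a - i, b - j)"
  by (simp add: mon_def lookup_single_times)

lemma lookup_evalX:
  "Poly_Mapping.lookup (evalX p) (i, j) = (if j = 0 \<and> 0 \<le> i then coeff p (nat i) else 0)"
proof (induction p arbitrary: i j)
  case (pCons c p)
  show ?case
  proof (cases "i \<le> 0")
    case True
    then show ?thesis
      by (cases "i = 0")
        (auto simp: evalX_pCons lookup_add lookup_mon_times pCons.IH lookup_single when_def zero_prod_def)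
  next
    case False
    then have "nat i = Suc (nat (i - 1))" by simp
    then show ?thesis using False
      by (auto simp: evalX_pCons lookup_add lookup_mon_times pCons.IH lookup_single when_def zero_prod_def)
  qed
qed auto

text \<open>The image of \<open>y^j\<close> is \<open>x^(-nj) (1 + s)^j\<close>, of degree
  \<open>j\<close> in \<open>s\<close>, so only the coefficient of \<open>y^d\<close> reaches
  \<open>s^d\<close>, shifted by \<open>x^(-nd)\<close>. Injectivity of \<open>evalA\<close> follows
  by looking at the leading coefficient.\<close>

lemma lookup_evalA_top:
  assumes "degree a \<le> d"
  shows "Poly_Mapping.lookup (evalA a) (i, int d) = Poly_Mapping.lookup (evalX (coeff a d)) (i + int n * int d, 0)"
  using assms
proof (induction a arbitrary: i d)
  case (pCons c a)
  have *: "Poly_Mapping.lookup (evalA (pCons c a)) (i, int d) = Poly_Mapping.lookup (evalX c) (i, int d)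
      + Poly_Mapping.lookup (evalA a) (i + int n, int d) + Poly_Mapping.lookup (evalA a) (i + int n, int d - 1)"
    by (simp add: evalA_pCons lookup_add lookup_mon_times distrib_left distrib_right mult.assoc)
  show ?case
  proof (cases "a = 0")
    case True
    then show ?thesis
      by (cases d) (auto simp: evalA_pCons lookup_evalX)
  next
    case False
    with pCons.prems obtain d' where d: "d = Suc d'" "degree a \<le> d'"
      by (cases d) auto
    have "coeff a (Suc d') = 0" using d by (intro coeff_eq_0) simp
    then show ?thesis
      using * d pCons.IH[of "Suc d'" "i + int n"] pCons.IH[of d' "i + int n"]
      by (simp add: lookup_evalX algebra_simps)
  qed
qed auto

lemma evalA_eq_0_iff: "evalA a = 0 \<longleftrightarrow> a = 0"
proof
  assume "evalA a = 0"
  have "coeff (lead_coeff a) i = 0" for i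
    using lookup_evalA_top[of a "degree a" "int i - int n * int (degree a)"] \<open>evalA a = 0\<close>
    by (simp add: lookup_evalX)
  then have "lead_coeff a = 0" by (simp add: poly_eq_iff)
  then show "a = 0" by simp
qed simp

end

section \<open>The rings A and B_n inside the fraction field\<close>

lemma embA_0 [simp]: "embA 0 = 0"
  by (simp add: embA_def Zero_fract_def)

lemma embA_1 [simp]: "embA 1 = 1"
  by (simp add: embA_def One_fract_def)

lemma embA_add: "embA (a + b) = embA a + embA b"
  by (simp add: embA_def)

lemma embA_minus: "embA (- a) = - embA a"
  by (simp add: embA_def)

lemma embA_diff: "embA (a - b) = embA a - embA b"
  by (simp add: embA_def)

lemma embA_mult: "embA (a * b) = embA a * embA b"
  by (simp add: embA_def)

lemma embA_power: "embA (a ^ d) = embA a ^ d"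
  by (induction d) (auto simp: embA_mult)

lemma embA_eq_iff: "embA a = embA b \<longleftrightarrow> a = b"
  by (simp add: embA_def eq_fract)

text \<open>This is the element \<open>s\<close>, which \<open>evalA\<close> sends to the invertible
  monomial \<open>mon 0 1\<close>.\<close>

definition denom :: "nat \<Rightarrow> 'k::field poly poly" where
  "denom n = varX ^ n * varY - 1"

lemma denom_nonzero: "denom n \<noteq> 0"
  using evalA_denominator[of n] mon_nonzero[of 0 1] unfolding denom_def by (metis evalA_0)

lemma tgen_times_denom: "tgen n * embA (denom n) = embA (varX - 1)"
  unfolding tgen_def embA_def denom_def[symmetric] by (simp add: eq_fract denom_nonzero)

text \<open>The equation \<open>t s = x - 1\<close> in subtraction-free form, ready for maps known
  only to respect sums and products.\<close>

lemma tgen_relation: "tgen n * embA varX ^ n * embA varY + 1 = embA varX + tgen n"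
  using tgen_times_denom[of n]
  by (simp add: denom_def embA_diff embA_mult embA_power algebra_simps)

lemma tgen_nonzero: "tgen n \<noteq> (0 :: 'k::field poly poly fract)"
proof
  assume "tgen n = (0 :: 'k poly poly fract)"
  then have "embA (varX - 1 :: 'k poly poly) = embA 0" by (simp flip: tgen_times_denom[of n])
  then show False by (simp only: embA_eq_iff) (simp add: varX_def one_pCons)
qed

lemma Bring_add: "a \<in> Bring n \<Longrightarrow> b \<in> Bring n \<Longrightarrow> a + b \<in> Bring n"
  unfolding Bring_def by (auto simp: embA_add simp flip: poly_map_poly_add)

lemma Bring_mult: "a \<in> Bring n \<Longrightarrow> b \<in> Bring n \<Longrightarrow> a * b \<in> Bring n"
  unfolding Bring_def by (auto simp: embA_add embA_mult simp flip: poly_map_poly_mult)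

lemma Bring_embA: "embA a \<in> Bring n"
  unfolding Bring_def by (auto intro!: exI[of _ "[:a:]"] simp: poly_map_poly_pCons)

lemma Bring_tgen: "tgen n \<in> Bring n"
  unfolding Bring_def by (auto intro!: exI[of _ "[:0, 1:]"] simp: poly_map_poly_pCons)

lemma Bring_scalar: "scalar c \<in> Bring n"
  by (simp add: scalar_def Bring_embA)

lemma Bring_0: "0 \<in> Bring n" and Bring_1: "1 \<in> Bring n"
  using Bring_embA[of 0 n] Bring_embA[of 1 n] by simp_all

lemma Bring_minus: "a \<in> Bring n \<Longrightarrow> - a \<in> Bring n"
  using Bring_mult[OF Bring_embA[of "-1" n]] by (simp add: embA_minus)

lemma Bring_diff: "a \<in> Bring n \<Longrightarrow> b \<in> Bring n \<Longrightarrow> a - b \<in> Bring n"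
  using Bring_add[OF _ Bring_minus] by fastforce

lemma Bring_power: "a \<in> Bring n \<Longrightarrow> a ^ d \<in> Bring n"
  by (induction d) (auto simp: Bring_1 Bring_mult)

lemmas Bring_closed = Bring_add Bring_mult Bring_embA Bring_tgen Bring_scalar Bring_0 Bring_1
  Bring_minus Bring_diff Bring_power

lemma Bring_induct [consumes 1, case_names scalar varX varY tgen add mult]:
  assumes "b \<in> Bring n"
    and sc: "\<And>c. P (scalar c)" and x: "P (embA varX)" and y: "P (embA varY)" and t: "P (tgen n)"
    and add: "\<And>a b. a \<in> Bring n \<Longrightarrow> b \<in> Bring n \<Longrightarrow> P a \<Longrightarrow> P b \<Longrightarrow> P (a + b)"
    and mult: "\<And>a b. a \<in> Bring n \<Longrightarrow> b \<in> Bring n \<Longrightarrow> P a \<Longrightarrow> P b \<Longrightarrow> P (a * b)"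
  shows "P b"
proof -
  have 0: "P 0" using sc[of 0] by (simp add: scalar_def)
  have X: "P (embA [:p:])" for p
  proof (induction p)
    case (pCons c p)
    have "[:pCons c p:] = [:[:c:]:] + varX * [:p:]" by (simp add: varX_def)
    then have "embA [:pCons c p:] = scalar c + embA varX * embA [:p:]"
      by (simp only: embA_add embA_mult scalar_def)
    then show ?case using pCons by (auto intro!: add mult sc x Bring_closed)
  qed (use 0 in simp)
  have A: "P (embA a)" for a
  proof (induction a)
    case (pCons c a)
    have "pCons c a = [:c:] + varY * a" by (simp add: varY_def)
    then have "embA (pCons c a) = embA [:c:] + embA varY * embA a"
      by (simp only: embA_add embA_mult)
    then show ?case using pCons by (auto intro!: add mult X y Bring_closed)
  qed (use 0 in simp)
  obtain q where b: "b = poly (map_poly embA q) (tgen n)"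
    using assms(1) by (auto simp: Bring_def)
  show ?thesis unfolding b
  proof (induction q)
    case (pCons c q)
    have "poly (map_poly embA q) (tgen n) \<in> Bring n" by (auto simp: Bring_def)
    then show ?case using pCons
      by (auto simp: poly_map_poly_pCons intro!: add mult A t Bring_closed)
  qed (use 0 in simp)
qed

section \<open>The embedding of B_n into Laurent polynomials\<close>

definition laurent_of :: "nat \<Rightarrow> ('k::field poly poly) fract \<Rightarrow> 'k laurent" where
  "laurent_of n b = (THE l. \<exists>p d. b * embA (denom n) ^ d = embA p \<and> l * mon 0 1 ^ d = evalA n p)"

lemma evalA_denom: "evalA n (denom n) = mon 0 1"
  by (simp add: denom_def evalA_denominator)

text \<open>Independence of the fraction \<open>p / s^d\<close>: two such fractions for
  \<open>b\<close> are cross-multiplied in A, the identity is carried over by \<open>evalA\<close>,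
  and the powers of \<open>mon 0 1\<close> cancel.\<close>

lemma laurent_of_eqI:
  assumes "b * embA (denom n) ^ d = embA p" and "l * mon 0 1 ^ d = evalA n p"
  shows "laurent_of n b = l"
  unfolding laurent_of_def
proof (rule the_equality)
  fix l' assume "\<exists>p d. b * embA (denom n) ^ d = embA p \<and> l' * mon 0 1 ^ d = evalA n p"
  then obtain p' d' where *: "b * embA (denom n) ^ d' = embA p'" "l' * mon 0 1 ^ d' = evalA n p'"
    by blast
  have "embA (p * denom n ^ d') = b * embA (denom n) ^ d * embA (denom n) ^ d'"
    by (simp add: assms(1) embA_mult embA_power)
  also have "\<dots> = embA (p' * denom n ^ d)"
    by (simp add: *(1)[symmetric] embA_mult embA_power mult_ac)
  finally have "p * denom n ^ d' = p' * denom n ^ d" by (simp only: embA_eq_iff)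
  then have "evalA n p * mon 0 1 ^ d' = evalA n p' * mon 0 1 ^ d"
    by (metis evalA_mult evalA_power evalA_denom)
  then have "l * (mon 0 1 ^ d * mon 0 1 ^ d') = l' * (mon 0 1 ^ d * mon 0 1 ^ d')"
    by (simp add: assms(2)[symmetric] *(2)[symmetric] mult_ac)
  then show "l' = l" by (simp add: mon_nonzero)
qed (use assms in blast)

lemma Bring_fraction:
  assumes "b \<in> Bring n"
  shows "\<exists>p d. b * embA (denom n) ^ d = embA p"
  using assms
proof (induction rule: Bring_induct)
  case (scalar c)
  show ?case by (rule exI[of _ "[:[:c:]:]"], rule exI[of _ 0]) (simp add: scalar_def)
next
  case varX
  show ?case by (rule exI[of _ "varX"], rule exI[of _ 0]) simp
next
  case varY
  show ?case by (rule exI[of _ "varY"], rule exI[of _ 0]) simp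
next
  case tgen
  show ?case by (rule exI[of _ "varX - 1"], rule exI[of _ 1]) (simp add: tgen_times_denom)
next
  case (add a b)
  then obtain p d p' d' where *: "a * embA (denom n) ^ d = embA p" "b * embA (denom n) ^ d' = embA p'"
    by blast
  have "(a + b) * embA (denom n) ^ (d + d') = embA (p * denom n ^ d' + p' * denom n ^ d)"
    by (simp add: embA_add embA_mult embA_power *[symmetric] power_add algebra_simps)
  then show ?case by blast
next
  case (mult a b)
  then obtain p d p' d' where *: "a * embA (denom n) ^ d = embA p" "b * embA (denom n) ^ d' = embA p'"
    by blast
  have "(a * b) * embA (denom n) ^ (d + d') = embA (p * p')"
    by (simp add: embA_mult *[symmetric] power_add algebra_simps)
  then show ?case by blast
qed

lemma laurent_of:
  assumes "b \<in> Bring n"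
  obtains p d where "b * embA (denom n) ^ d = embA p" and "laurent_of n b * mon 0 1 ^ d = evalA n p"
proof -
  obtain p d where *: "b * embA (denom n) ^ d = embA p" using Bring_fraction[OF assms] by blast
  \<comment> \<open>Existence of the value: \<open>s\<close> is invertible among Laurent
    polynomials.\<close>
  have "evalA n p * mon 0 (- int d) * mon 0 1 ^ d = evalA n p"
    by (simp add: mult.assoc mon_power mon_mult mon_0_0)
  with laurent_of_eqI[OF * this] * that show ?thesis by metis
qed

lemma laurent_of_add:
  assumes "a \<in> Bring n" and "b \<in> Bring n"
  shows "laurent_of n (a + b) = laurent_of n a + laurent_of n b"
proof -
  obtain p d where p: "a * embA (denom n) ^ d = embA p" "laurent_of n a * mon 0 1 ^ d = evalA n p"
    using laurent_of[OF assms(1)] .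
  obtain q e where q: "b * embA (denom n) ^ e = embA q" "laurent_of n b * mon 0 1 ^ e = evalA n q"
    using laurent_of[OF assms(2)] .
  show ?thesis
  proof (rule laurent_of_eqI)
    show "(a + b) * embA (denom n) ^ (d + e) = embA (p * denom n ^ e + q * denom n ^ d)"
      by (simp add: embA_add embA_mult embA_power p(1)[symmetric] q(1)[symmetric] power_add algebra_simps)
    show "(laurent_of n a + laurent_of n b) * mon 0 1 ^ (d + e) = evalA n (p * denom n ^ e + q * denom n ^ d)"
      by (simp add: evalA_add evalA_mult evalA_power evalA_denom p(2)[symmetric] q(2)[symmetric]
          power_add algebra_simps)
  qed
qed

lemma laurent_of_mult:
  assumes "a \<in> Bring n" and "b \<in> Bring n"
  shows "laurent_of n (a * b) = laurent_of n a * laurent_of n b"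
proof -
  obtain p d where p: "a * embA (denom n) ^ d = embA p" "laurent_of n a * mon 0 1 ^ d = evalA n p"
    using laurent_of[OF assms(1)] .
  obtain q e where q: "b * embA (denom n) ^ e = embA q" "laurent_of n b * mon 0 1 ^ e = evalA n q"
    using laurent_of[OF assms(2)] .
  show ?thesis
  proof (rule laurent_of_eqI)
    show "(a * b) * embA (denom n) ^ (d + e) = embA (p * q)"
      by (simp add: embA_mult p(1)[symmetric] q(1)[symmetric] power_add algebra_simps)
    show "(laurent_of n a * laurent_of n b) * mon 0 1 ^ (d + e) = evalA n (p * q)"
      by (simp add: evalA_mult p(2)[symmetric] q(2)[symmetric] power_add algebra_simps)
  qed
qed

lemma laurent_of_embA: "laurent_of n (embA a) = evalA n a"
  by (rule laurent_of_eqI[of _ _ 0]) auto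

lemma laurent_of_tgen: "laurent_of n (tgen n) = (mon 1 0 - 1) * mon 0 (-1)"
  by (rule laurent_of_eqI[of _ _ 1 "varX - 1"])
    (auto simp: tgen_times_denom evalA_diff evalA_varX mult.assoc mon_mult mon_0_0)

lemma laurent_of_eq_0:
  fixes b :: "'k::field poly poly fract"
  assumes "b \<in> Bring n" and "laurent_of n b = 0"
  shows "b = 0"
proof -
  obtain p d where p: "b * embA (denom n) ^ d = embA p" "laurent_of n b * mon 0 1 ^ d = evalA n p"
    using laurent_of[OF assms(1)] .
  then have "p = 0" using assms(2) by (simp add: evalA_eq_0_iff)
  moreover have "embA (denom n) \<noteq> (0 :: 'k poly poly fract)"
    using denom_nonzero[of n] embA_eq_iff[of "denom n :: 'k poly poly" 0] by simp
  ultimately show ?thesis using p(1) by simp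
qed

subsection \<open>The bracket on the embedded ring\<close>

lemma laurent_of_scalar: "laurent_of n (scalar c) = Poly_Mapping.single 0 c"
  by (simp add: scalar_def laurent_of_embA evalA_const)

lemma laurent_of_1: "laurent_of n 1 = 1"
  using laurent_of_embA[of n 1] by simp

lemma laurent_of_diff:
  assumes "a \<in> Bring n" and "b \<in> Bring n"
  shows "laurent_of n (a - b) = laurent_of n a - laurent_of n b"
  using laurent_of_add[of "a - b" n b] assms by (simp add: Bring_diff)

lemma laurent_of_power:
  assumes "a \<in> Bring n"
  shows "laurent_of n (a ^ d) = laurent_of n a ^ d"
  by (induction d) (use assms in \<open>auto simp: laurent_of_1 laurent_of_mult Bring_power\<close>)

lemma laurent_of_inj:
  assumes "a \<in> Bring n" and "b \<in> Bring n" and "laurent_of n a = laurent_of n b"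
  shows "a = b"
  using laurent_of_eq_0[of "a - b" n] assms by (simp add: laurent_of_diff Bring_diff)

section \<open>The image of B_n as a subring of the Laurent polynomials\<close>

definition laurent_ring :: "nat \<Rightarrow> 'k::field laurent set" where
  "laurent_ring n = laurent_of n ` Bring n"

lemma laurent_ring_add: "a \<in> laurent_ring n \<Longrightarrow> b \<in> laurent_ring n \<Longrightarrow> a + b \<in> laurent_ring n"
  unfolding laurent_ring_def by (auto simp flip: laurent_of_add intro!: imageI Bring_add)

lemma laurent_ring_diff: "a \<in> laurent_ring n \<Longrightarrow> b \<in> laurent_ring n \<Longrightarrow> a - b \<in> laurent_ring n"
  unfolding laurent_ring_def by (auto simp flip: laurent_of_diff intro!: imageI Bring_diff)

lemma laurent_ring_mult: "a \<in> laurent_ring n \<Longrightarrow> b \<in> laurent_ring n \<Longrightarrow> a * b \<in> laurent_ring n"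
  unfolding laurent_ring_def by (auto simp flip: laurent_of_mult intro!: imageI Bring_mult)

lemma laurent_ring_const: "Poly_Mapping.single 0 c \<in> laurent_ring n"
  unfolding laurent_ring_def by (auto simp flip: laurent_of_scalar[of n] intro!: imageI Bring_scalar)

lemma laurent_ring_of_nat: "of_nat d \<in> laurent_ring n"
  using laurent_ring_const[of "of_nat d" n] by simp

lemma laurent_ring_1: "1 \<in> laurent_ring n"
  using laurent_ring_of_nat[of 1] by simp

lemma laurent_ring_0: "0 \<in> laurent_ring n"
  using laurent_ring_of_nat[of 0] by simp

lemma laurent_ring_uminus: "a \<in> laurent_ring n \<Longrightarrow> - a \<in> laurent_ring n"
  using laurent_ring_diff[OF laurent_ring_0] by fastforce

lemma laurent_ring_power: "a \<in> laurent_ring n \<Longrightarrow> a ^ d \<in> laurent_ring n"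
  by (induction d) (auto simp: laurent_ring_1 laurent_ring_mult)

lemma laurent_ring_sum: "(\<And>i. i \<in> A \<Longrightarrow> f i \<in> laurent_ring n) \<Longrightarrow> sum f A \<in> laurent_ring n"
  by (induction A rule: infinite_finite_induct) (auto simp: laurent_ring_0 laurent_ring_add)

lemma laurent_ring_induct [consumes 1, case_names const x y t add mult]:
  assumes "r \<in> laurent_ring n"
    and "\<And>c. P (Poly_Mapping.single 0 c)" and "P (mon 1 0)"
    and "P (mon (- int n) 0 * (1 + mon 0 1))" and "P ((mon 1 0 - 1) * mon 0 (-1))"
    and "\<And>a b. a \<in> laurent_ring n \<Longrightarrow> b \<in> laurent_ring n \<Longrightarrow> P a \<Longrightarrow> P b \<Longrightarrow> P (a + b)"
    and "\<And>a b. a \<in> laurent_ring n \<Longrightarrow> b \<in> laurent_ring n \<Longrightarrow> P a \<Longrightarrow> P b \<Longrightarrow> P (a * b)"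
  shows "P r"
proof -
  obtain b where b: "b \<in> Bring n" "r = laurent_of n b"
    using assms(1) by (auto simp: laurent_ring_def)
  show ?thesis unfolding b(2) using b(1)
  proof (induction rule: Bring_induct)
    case (add a b)
    then show ?case using assms(6) by (simp add: laurent_of_add laurent_ring_def)
  next
    case (mult a b)
    then show ?case using assms(7) by (simp add: laurent_of_mult laurent_ring_def)
  qed (use assms in \<open>simp_all add: laurent_of_scalar laurent_of_embA laurent_of_tgen evalA_varX evalA_varY\<close>)
qed

lemma laurent_ring_gens:
  "mon 1 0 \<in> laurent_ring n" "mon (- int n) 0 * (1 + mon 0 1) \<in> laurent_ring n"
  "(mon 1 0 - 1) * mon 0 (-1) \<in> laurent_ring n"
  unfolding laurent_ring_def
  by (metis Bring_embA evalA_varX imageI laurent_of_embA,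
      metis Bring_embA evalA_varY imageI laurent_of_embA,
      metis Bring_tgen imageI laurent_of_tgen)

text \<open>The bracket is a derivation in its second argument, so the \<open>g\<close> with
  \<open>h * bracket f g\<close> in the ring are closed under sums and products of ring elements;
  the three generators suffice.\<close>

lemma laurent_ring_bracket_aux:
  assumes "\<And>g. g \<in> {mon 1 0, mon (- int n) 0 * (1 + mon 0 1), (mon 1 0 - 1) * mon 0 (-1)} \<Longrightarrow>
      h * bracket f g \<in> laurent_ring n" and "g \<in> laurent_ring n"
  shows "h * bracket f g \<in> laurent_ring n"
  using assms(2)
proof (induction rule: laurent_ring_induct)
  case (const c)
  show ?case by (simp add: bracket_const_right laurent_ring_0)
next
  case (add a b)
  then show ?case by (simp add: bracket_add_right distrib_left laurent_ring_add)
next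
  case (mult a b)
  have "h * bracket f (a * b) = a * (h * bracket f b) + b * (h * bracket f a)"
    by (simp add: bracket_mult_right algebra_simps)
  then show ?case using mult by (simp add: laurent_ring_add laurent_ring_mult)
qed (rule assms(1); blast)+

text \<open>With \<open>y = (1 + s)/x\<^sup>n\<close> and \<open>t = (x - 1)/s\<close> one has \<open>[x, y] = x\<^bsup>1-n\<^esup> s\<close>,
  \<open>[x, t] = - x t\<close> and \<open>[y, t] = n y t - x\<^bsup>1-n\<^esup>\<close>: the bracket has a pole along \<open>x = 0\<close> that
  is cleared by \<open>x\<^bsup>n-1\<^esup>\<close>.\<close>

lemma laurent_ring_bracket:
  fixes f g :: "'k::field laurent"
  assumes n: "n \<ge> 1" and f: "f \<in> laurent_ring n" and g: "g \<in> laurent_ring n"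
  shows "mon (int n - 1) 0 * bracket f g \<in> laurent_ring n"
proof -
  define x :: "'k laurent" where "x = mon 1 0"
  define s :: "'k laurent" where "s = mon 0 1"
  define si :: "'k laurent" where "si = mon 0 (-1)"
  define xi :: "'k laurent" where "xi = mon (- int n) 0"
  define y where "y = xi * (1 + s)"
  define t where "t = (x - 1) * si"
  define h :: "'k laurent" where "h = mon (int n - 1) 0"
  have gens: "x \<in> laurent_ring n" "y \<in> laurent_ring n" "t \<in> laurent_ring n"
    unfolding x_def y_def t_def s_def si_def xi_def by (rule laurent_ring_gens)+
  have hx: "h * x * xi = 1" "s * si = 1" "h = x ^ (n - 1)" "h * x = x ^ n"
    using n by (simp_all add: h_def x_def s_def si_def xi_def mon_mult mon_0_0 mon_power)
  have s: "s \<in> laurent_ring n"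
  proof -
    have "s = x ^ n * y - 1"
      using hx by (simp add: y_def algebra_simps flip: hx(4))
    then show ?thesis using gens by (simp add: laurent_ring_diff laurent_ring_mult laurent_ring_power laurent_ring_1)
  qed
  have h: "h \<in> laurent_ring n" using gens hx by (simp add: laurent_ring_power)
  have w0: "weight_deriv fst (1 :: 'k laurent) = 0" "weight_deriv snd (1 :: 'k laurent) = 0"
    by (simp_all add: weight_deriv_1)
  have D: "weight_deriv fst x = x" "weight_deriv snd x = 0"
      "weight_deriv fst s = 0" "weight_deriv snd s = s"
      "weight_deriv fst si = 0" "weight_deriv snd si = - si"
      "weight_deriv fst xi = - of_nat n * xi" "weight_deriv snd xi = 0"
    by (simp_all add: x_def s_def si_def xi_def weight_deriv_mon)
  have Dy: "weight_deriv fst y = - of_nat n * y" "weight_deriv snd y = xi * s"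
    by (simp_all add: y_def weight_deriv_times weight_deriv_add D w0 algebra_simps)
  have Dt: "weight_deriv fst t = x * si" "weight_deriv snd t = - t"
    by (simp_all add: t_def weight_deriv_times weight_deriv_diff D w0 algebra_simps)
  have xy: "h * bracket x y = s"
    using hx by (simp add: bracket_def D Dy algebra_simps)
  have xt: "h * bracket x t = - (h * x * t)"
    by (simp add: bracket_def D Dt algebra_simps)
  have "h * bracket y t = of_nat n * (h * (y * t)) - (h * x * xi) * (s * si)"
    by (simp add: bracket_def Dy Dt algebra_simps)
  then have yt: "h * bracket y t = of_nat n * (h * (y * t)) - 1"
    using hx by simp
  have base: "h * bracket x y \<in> laurent_ring n" "h * bracket x t \<in> laurent_ring n"
    "h * bracket y t \<in> laurent_ring n"
    unfolding xy xt yt using s h gens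
    by (auto intro!: laurent_ring_mult laurent_ring_diff laurent_ring_uminus laurent_ring_of_nat laurent_ring_1)
  have base': "h * bracket a b \<in> laurent_ring n" if "a \<in> {x, y, t}" "b \<in> {x, y, t}" for a b
    using that base bracket_commute[of y x] bracket_commute[of t x] bracket_commute[of t y]
    by (auto simp: bracket_self laurent_ring_0 laurent_ring_uminus)
  note aux = laurent_ring_bracket_aux[where n = n and h = h,
      folded x_def s_def si_def xi_def, folded y_def t_def]
  \<comment> \<open>The generators are replaced one argument at a time: first the second argument
    becomes \<open>g\<close>, then, after swapping by antisymmetry, the other becomes
    \<open>f\<close>.\<close>
  have "h * bracket a g \<in> laurent_ring n" if "a \<in> {x, y, t}" for a
    by (rule aux[OF base' g]) (use that in auto)
  then have "h * bracket g a \<in> laurent_ring n" if "a \<in> {x, y, t}" for a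
    using that bracket_commute[of g a] by (simp add: laurent_ring_uminus)
  then have "h * bracket g f \<in> laurent_ring n"
    by (rule aux[OF _ f])
  then show ?thesis
    using bracket_commute[of f g] by (simp add: laurent_ring_uminus flip: h_def)
qed

text \<open>\<open>[x, y]\<close> is the single monomial \<open>x^(1-n) s\<close> with coefficient
  1, so it survives in every characteristic.\<close>

lemma bracket_gens_nonzero:
  "bracket (mon 1 0) (mon (- int n) 0 * (1 + mon 0 1)) \<noteq> (0 :: 'k::field laurent)"
proof -
  have "bracket (mon 1 0) (mon (- int n) 0 * (1 + mon 0 1)) = (mon (1 - int n) 1 :: 'k laurent)"
    by (simp add: bracket_def weight_deriv_mon weight_deriv_times weight_deriv_add
        weight_deriv_1 mon_mult)
  then show ?thesis by (simp add: mon_nonzero)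
qed

section \<open>Residues modulo x\<close>

lemma map_poly_const_mult:
  fixes p q :: "'a::comm_ring_1 poly"
  shows "map_poly (\<lambda>c. [:c:]) (p * q) = map_poly (\<lambda>c. [:c:]) p * map_poly (\<lambda>c. [:c:]) q"
  by (intro poly_eqI) (simp add: coeff_map_poly coeff_mult mult.commute flip: sum_to_poly)

text \<open>\<open>map_poly (\<lambda>c. [:c:]) p\<close> is \<open>p(y)\<close>, a polynomial free
  of \<open>x\<close>. Modulo \<open>x\<close> one has \<open>s = -1\<close>, so
  \<open>t s = x - 1\<close> forces \<open>t = 1\<close>, and \<open>y\<close> alone generates the
  residues over k.\<close>

lemma Bring_mod_varX:
  fixes b :: "'k::field poly poly fract"
  assumes n: "n \<ge> 1" and "b \<in> Bring n"
  shows "\<exists>b' p. b' \<in> Bring n \<and> b = embA varX * b' + embA (map_poly (\<lambda>c. [:c:]) p)"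
  using assms(2)
proof (induction rule: Bring_induct)
  case (scalar c)
  have "scalar c = embA varX * 0 + embA (map_poly (\<lambda>c. [:c:]) [:c:])"
    by (simp add: scalar_def map_poly_pCons)
  then show ?case using Bring_0 by blast
next
  case varX
  have "embA varX = embA varX * 1 + embA (map_poly (\<lambda>c. [:c:]) 0)" by simp
  then show ?case using Bring_1 by blast
next
  case varY
  have "embA varY = embA varX * 0 + embA (map_poly (\<lambda>c. [:c:]) [:0, 1:])"
    by (simp add: varY_def map_poly_pCons one_pCons)
  then show ?case using Bring_0 by blast
next
  case tgen
  obtain n' where n': "n = Suc n'" using n by (cases n) auto
  have "tgen n * embA varX ^ n * embA varY + 1 = embA varX + (tgen n :: 'k poly poly fract)"
    by (rule tgen_relation)
  then have "(tgen n :: 'k poly poly fract) = embA varX * (tgen n * embA varX ^ (n - 1) * embA varY - 1) + 1"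
    by (simp add: algebra_simps n')
  moreover have "embA (map_poly (\<lambda>c. [:c:]) 1) = (1 :: 'k poly poly fract)"
    by (simp add: map_poly_1' flip: one_pCons)
  ultimately have "tgen n = embA varX * (tgen n * embA varX ^ (n - 1) * embA varY - 1)
      + embA (map_poly (\<lambda>c. [:c:]) (1 :: 'k poly))" by simp
  moreover have "tgen n * embA varX ^ (n - 1) * embA varY - 1 \<in> Bring n"
    by (intro Bring_closed)
  ultimately show ?case by blast
next
  case (add a b)
  then obtain a' p b' q where *: "a' \<in> Bring n" "a = embA varX * a' + embA (map_poly (\<lambda>c. [:c:]) p)"
    "b' \<in> Bring n" "b = embA varX * b' + embA (map_poly (\<lambda>c. [:c:]) q)" by blast
  have "map_poly (\<lambda>c. [:c:]) (p + q) = map_poly (\<lambda>c. [:c:]) p + map_poly (\<lambda>c. [:c:]) q"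
    by (simp add: poly_eq_iff coeff_map_poly)
  then have "a + b = embA varX * (a' + b') + embA (map_poly (\<lambda>c. [:c:]) (p + q))"
    by (simp add: * embA_add algebra_simps)
  then show ?case using * Bring_add by blast
next
  case (mult a b)
  then obtain a' p b' q where *: "a' \<in> Bring n" "a = embA varX * a' + embA (map_poly (\<lambda>c. [:c:]) p)"
    "b' \<in> Bring n" "b = embA varX * b' + embA (map_poly (\<lambda>c. [:c:]) q)" by blast
  have "a * b = embA varX * (a' * b + embA (map_poly (\<lambda>c. [:c:]) p) * b')
     + embA (map_poly (\<lambda>c. [:c:]) (p * q))"
    by (simp add: * map_poly_const_mult embA_mult algebra_simps)
  moreover have "a' * b + embA (map_poly (\<lambda>c. [:c:]) p) * b' \<in> Bring n"
    using * mult by (intro Bring_closed)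
  ultimately show ?case by blast
qed

subsection \<open>Divisibility by the first variable\<close>

text \<open>After clearing denominators set \<open>x = 0\<close>, which is the map
  \<open>c0\<close>: the denominator \<open>s^d\<close> becomes \<open>(-1)^d\<close>, so
  \<open>p\<close> itself must vanish. With \<open>Bring_mod_varX\<close> this identifies
  \<open>B_n/(x)\<close> with \<open>k[y]\<close>.\<close>

lemma varX_not_dvd_const:
  assumes n: "n \<ge> 1" and "b \<in> Bring n" and eq: "embA varX * b = embA (map_poly (\<lambda>c. [:c:]) p)"
  shows "p = (0 :: 'k::field poly)"
proof (rule ccontr)
  assume "p \<noteq> 0"
  define c0 where "c0 = (\<lambda>a :: 'k poly poly. map_poly (\<lambda>q. coeff q 0) a)"
  obtain a d where a: "b * embA (denom n) ^ d = embA a" using Bring_fraction[OF assms(2)] by blast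
  have "embA (varX * a) = embA varX * b * embA (denom n) ^ d"
    using a by (simp add: embA_mult mult.assoc)
  also have "\<dots> = embA (map_poly (\<lambda>c. [:c:]) p * denom n ^ d)"
    unfolding eq by (simp add: embA_mult embA_power)
  finally have *: "varX * a = map_poly (\<lambda>c. [:c:]) p * denom n ^ d"
    by (simp only: embA_eq_iff)
  have ev_mult: "c0 (q * r) = c0 q * c0 r" for q r
    by (intro poly_eqI) (simp add: c0_def coeff_map_poly coeff_mult coeff_sum coeff_mult_0)
  have c0_1: "c0 1 = 1" by (simp add: c0_def map_poly_1')
  have ev_power: "c0 (q ^ i) = c0 q ^ i" for q i
    by (induction i) (simp_all add: ev_mult c0_1)
  have varX: "c0 varX = 0" by (simp add: c0_def varX_def map_poly_pCons)
  have "c0 (denom n) = c0 (varX ^ n * varY) - c0 1"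
    by (intro poly_eqI) (simp add: c0_def denom_def coeff_map_poly)
  also have "\<dots> = - 1" using n by (simp add: ev_mult ev_power varX c0_1 power_0_left)
  finally have "c0 (denom n) = - 1" .
  moreover have "c0 (map_poly (\<lambda>c. [:c:]) p) = p"
    by (intro poly_eqI) (simp add: c0_def coeff_map_poly)
  ultimately have "p * (- 1) ^ d = 0"
    using arg_cong[OF *, of c0] by (simp add: ev_mult ev_power varX)
  with \<open>p \<noteq> 0\<close> show False by simp
qed

lemma varX_not_unit:
  assumes "n \<ge> 1" and "b \<in> Bring n" and "c \<noteq> 0"
  shows "embA varX * b \<noteq> scalar c"
  using varX_not_dvd_const[OF assms(1,2), of "[:c:]"] assms(3)
  by (auto simp: scalar_def map_poly_pCons)

text \<open>The residues of \<open>a\<close> and \<open>b\<close> are polynomials \<open>p\<close>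
  and \<open>q\<close> in \<open>y\<close> with \<open>p * q = 0\<close>, and \<open>k[y]\<close> is
  a domain.\<close>

lemma varX_prime:
  assumes n: "n \<ge> 1" and ab: "a \<in> Bring n" "b \<in> Bring n" and c: "c \<in> Bring n"
    and eq: "a * b = embA varX * c"
  shows "(\<exists>a' \<in> Bring n. a = embA varX * a') \<or> (\<exists>b' \<in> Bring n. b = embA varX * b')"
proof -
  obtain a' p where a: "a' \<in> Bring n" "a = embA varX * a' + embA (map_poly (\<lambda>c. [:c:]) p)"
    using Bring_mod_varX[OF n ab(1)] by blast
  obtain b' q where b: "b' \<in> Bring n" "b = embA varX * b' + embA (map_poly (\<lambda>c. [:c:]) q)"
    using Bring_mod_varX[OF n ab(2)] by blast
  have "embA varX * (c - a' * b - embA (map_poly (\<lambda>c. [:c:]) p) * b')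
      = embA (map_poly (\<lambda>c. [:c:]) (p * q))"
    using eq a(2) b(2) by (simp add: map_poly_const_mult embA_mult algebra_simps)
  moreover have "c - a' * b - embA (map_poly (\<lambda>c. [:c:]) p) * b' \<in> Bring n"
    using a b ab c by (intro Bring_closed)
  ultimately have "p * q = 0" using varX_not_dvd_const[OF n] by blast
  then have "p = 0 \<or> q = 0" by simp
  then show ?thesis using a b by auto
qed

lemma embA_varX_nonzero: "embA varX \<noteq> (0 :: 'k::field poly poly fract)"
proof -
  have "embA (varX :: 'k poly poly) \<noteq> embA 0"
    by (simp only: embA_eq_iff) (simp add: varX_def)
  then show ?thesis by simp
qed

text \<open>By primality \<open>x\<close> divides \<open>a\<close> or the cofactor \<open>b\<close>;
  in the second case one factor \<open>x\<close> cancels and the induction on \<open>d\<close>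
  continues. At \<open>d = 0\<close>, \<open>a\<close> divides a nonzero constant.\<close>

lemma divisor_of_varX_power:
  assumes n: "n \<ge> 1" and "a \<in> Bring n" and "b \<in> Bring n" and "c \<noteq> 0"
    and "a * b = scalar c * embA varX ^ d"
  shows "(\<exists>v \<in> Bring n. a * v = 1) \<or> (\<exists>a' \<in> Bring n. a = embA varX * a')"
  using assms(2-)
proof (induction d arbitrary: b)
  case 0
  have "scalar c * scalar (inverse c) = 1"
    using 0 by (simp add: scalar_def flip: embA_mult one_pCons)
  then have "a * (b * scalar (inverse c)) = 1"
    using 0 by (simp flip: mult.assoc)
  then show ?case using 0 by (auto intro!: Bring_closed)
next
  case (Suc d)
  have "a * b = embA varX * (scalar c * embA varX ^ d)"
    using Suc.prems by simp
  moreover have "scalar c * embA varX ^ d \<in> Bring n" by (intro Bring_closed)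
  ultimately consider a' where "a' \<in> Bring n" "a = embA varX * a'"
    | b' where "b' \<in> Bring n" "b = embA varX * b'"
    using varX_prime[OF n Suc.prems(1,2)] by blast
  then show ?case
  proof cases
    case 2
    then have "a * b' = scalar c * embA varX ^ d"
      using Suc.prems by (simp add: embA_varX_nonzero mult.left_commute)
    then show ?thesis using Suc.IH 2 Suc.prems by blast
  qed blast
qed

text \<open>If \<open>k > d\<close>, the nonunit \<open>a\<close> divides a constant multiple of
  \<open>x^d\<close>, hence is a multiple of \<open>x\<close>. Then \<open>a^k\<close> carries more
  than \<open>d\<close> factors \<open>x\<close>, and cancelling \<open>x^d\<close> would make
  \<open>x\<close> divide a nonzero constant.\<close>

lemma power_divides_varX_power_imp_le:
  assumes n: "n \<ge> 1" and a: "a \<in> Bring n" and w: "w \<in> Bring n" and "c \<noteq> 0"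
    and eq: "w * a ^ k = scalar c * embA varX ^ d"
    and nonunit: "\<And>v. v \<in> Bring n \<Longrightarrow> a * v \<noteq> 1"
  shows "k \<le> d"
proof (rule ccontr)
  assume "\<not> k \<le> d"
  then obtain j where k: "k = Suc d + j" by (metis less_iff_Suc_add not_le add_Suc)
  then have "a * (w * a ^ (d + j)) = scalar c * embA varX ^ d"
    using eq by (simp add: mult_ac)
  moreover have "w * a ^ (d + j) \<in> Bring n" using a w by (intro Bring_closed)
  ultimately obtain a' where a': "a' \<in> Bring n" "a = embA varX * a'"
    using divisor_of_varX_power[OF n a _ \<open>c \<noteq> 0\<close>] nonunit by blast
  have "embA varX ^ d * (embA varX * (w * embA varX ^ j * a' ^ k)) = w * a ^ k"
    unfolding a' k by (simp add: power_mult_distrib power_add mult_ac)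
  also have "\<dots> = embA varX ^ d * scalar c" using eq by simp
  finally have "embA varX * (w * embA varX ^ j * a' ^ k) = scalar c"
    by (simp add: embA_varX_nonzero)
  moreover have "w * embA varX ^ j * a' ^ k \<in> Bring n" using w a' by (intro Bring_closed)
  ultimately show False using varX_not_unit[OF n _ \<open>c \<noteq> 0\<close>] by blast
qed

section \<open>Comparing the exponents through an isomorphism\<close>

lemma k_alg_iso_inverse:
  assumes "k_alg_iso f (Bring m) (Bring n)"
  shows "k_alg_iso (inv_into (Bring m) f) (Bring n) (Bring m)"
proof -
  let ?g = "inv_into (Bring m) f"
  have bij: "bij_betw f (Bring m) (Bring n)"
    and add: "\<And>a b. a \<in> Bring m \<Longrightarrow> b \<in> Bring m \<Longrightarrow> f (a + b) = f a + f b"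
    and mult: "\<And>a b. a \<in> Bring m \<Longrightarrow> b \<in> Bring m \<Longrightarrow> f (a * b) = f a * f b"
    and scal: "\<And>c a. a \<in> Bring m \<Longrightarrow> f (scalar c * a) = scalar c * f a"
    and one: "f 1 = 1"
    using assms by (auto simp: k_alg_iso_def)
  have g: "?g b \<in> Bring m" "f (?g b) = b" if "b \<in> Bring n" for b
    using that bij by (auto simp: bij_betw_def inv_into_into f_inv_into_f)
  have eqI: "?g b = a" if "a \<in> Bring m" "f a = b" for a b
    using that bij by (auto simp: bij_betw_def inv_into_f_f)
  show ?thesis
    unfolding k_alg_iso_def
    using bij by (auto simp: bij_betw_inv_into one add mult scal g intro!: eqI Bring_closed)
qed

lemma k_alg_iso_imp_le:
  fixes f :: "('k::field poly poly) fract \<Rightarrow> ('k poly poly) fract"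
  assumes m: "m \<ge> 1" and n: "n \<ge> 1"
    and iso: "k_alg_iso f (Bring m) (Bring n)"
  shows "m \<le> n"
proof -
  obtain k where k: "m = Suc k" using m by (cases m) auto
  have bij: "bij_betw f (Bring m) (Bring n)"
    and add: "\<And>a b. a \<in> Bring m \<Longrightarrow> b \<in> Bring m \<Longrightarrow> f (a + b) = f a + f b"
    and mult: "\<And>a b. a \<in> Bring m \<Longrightarrow> b \<in> Bring m \<Longrightarrow> f (a * b) = f a * f b"
    and scal: "\<And>c a. a \<in> Bring m \<Longrightarrow> f (scalar c * a) = scalar c * f a"
    and one: "f 1 = 1"
    using iso by (auto simp: k_alg_iso_def)
  have f_mem: "f a \<in> Bring n" if "a \<in> Bring m" for a using bij that by (auto simp: bij_betw_def)
  have f_inj: "a = b" if "a \<in> Bring m" "b \<in> Bring m" "f a = f b" for a b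
    using bij that by (auto simp: bij_betw_def inj_on_def)
  have f_surj: "\<exists>a \<in> Bring m. f a = b" if "b \<in> Bring n" for b
    using bij that by (metis bij_betw_def image_iff)
  have f_scalar: "f (scalar c) = scalar c" for c
    using scal[OF Bring_1, of c] by (simp add: one)
  have f_0: "f 0 = 0" using f_scalar[of 0] by (simp add: scalar_def)
  have f_power: "f (a ^ d) = f a ^ d" if "a \<in> Bring m" for a d
    by (induction d) (use that in \<open>auto simp: one mult Bring_power\<close>)
  define F where "F = (\<lambda>b. laurent_of n (f b))"
  have F_add: "F (a + b) = F a + F b" and F_mult: "F (a * b) = F a * F b"
    if "a \<in> Bring m" "b \<in> Bring m" for a b
    using that by (simp_all add: F_def add mult laurent_of_add laurent_of_mult f_mem)
  have F_scalar: "F (scalar c) = Poly_Mapping.single 0 c" for c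
    by (simp add: F_def f_scalar laurent_of_scalar)
  have F_1: "F 1 = 1" by (simp add: F_def one laurent_of_1)
  have F_power: "F (a ^ d) = F a ^ d" if "a \<in> Bring m" for a d
    using that by (simp add: F_def f_power laurent_of_power f_mem)
  have F_mem: "F a \<in> laurent_ring n" if "a \<in> Bring m" for a
    using that by (auto simp: F_def laurent_ring_def f_mem)
  have F_nonzero: "F a \<noteq> 0" if "a \<in> Bring m" "a \<noteq> 0" for a
    using that laurent_of_eq_0[OF f_mem] f_inj[OF _ Bring_0] f_0 by (auto simp: F_def)
  have F_surj: "\<exists>a \<in> Bring m. F a = r" if "r \<in> laurent_ring n" for r
    using that f_surj unfolding laurent_ring_def F_def by blast

  define X where "X = F (embA varX)"
  define Y where "Y = F (embA varY)"
  define T where "T = F (tgen m)"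
  note XYT = X_def Y_def T_def
  have X_nz: "X \<noteq> 0" and T_nz: "T \<noteq> 0"
    unfolding XYT by (intro F_nonzero Bring_closed embA_varX_nonzero tgen_nonzero)+
  have mem: "X \<in> laurent_ring n" "Y \<in> laurent_ring n" "T \<in> laurent_ring n"
    by (auto simp: XYT intro!: F_mem Bring_closed)
  have rel: "T * X ^ Suc k * Y + 1 = X + T"
  proof -
    have "F (tgen m * embA varX ^ m * embA varY + 1) = F (embA varX + tgen m)"
      by (simp only: tgen_relation)
    then show ?thesis
      by (simp add: F_add F_mult F_power F_1 Bring_closed XYT k del: power_Suc)
  qed
  define c where "c = of_nat (Suc k) * X ^ k * Y"
  define W where "W = T\<^sup>2 * (\<Sum>i<Suc k. X ^ i)"
  define u where "u = - bracket Y T - c * bracket X T - c * W * bracket X Y"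
  have br: "bracket X Y = u * (X ^ Suc k * Y - 1)" "bracket X T = - (u * (X ^ Suc k * T))"
    "bracket Y T = u * (c * T - 1)"
    using bracket_relations[OF rel] by (simp_all only: u_def c_def W_def)
  define h :: "'k laurent" where "h = mon (int n - 1) 0"
  have h: "h = mon 1 0 ^ (n - 1)" using n by (simp add: h_def mon_power)
  \<comment> \<open>\<open>u\<close> is a combination of brackets with coefficients in the ring, and
    \<open>h\<close>, the image of \<open>x^(n-1)\<close>, clears the pole of each bracket.\<close>
  have "- (h * u) \<in> laurent_ring n"
  proof -
    have "c \<in> laurent_ring n" "W \<in> laurent_ring n"
      unfolding c_def W_def using mem
      by (intro laurent_ring_mult laurent_ring_power laurent_ring_of_nat laurent_ring_sum; simp)+
    moreover have "h * bracket Y T \<in> laurent_ring n" "h * bracket X T \<in> laurent_ring n"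
      "h * bracket X Y \<in> laurent_ring n"
      using laurent_ring_bracket[OF n] mem by (auto simp: h_def)
    ultimately have "h * bracket Y T + c * (h * bracket X T) + c * W * (h * bracket X Y) \<in> laurent_ring n"
      by (simp add: laurent_ring_add laurent_ring_mult)
    then show ?thesis by (simp add: u_def algebra_simps)
  qed
  then obtain w where w: "w \<in> Bring m" "F w = - (h * u)" using F_surj by blast

  \<comment> \<open>If \<open>u = 0\<close>, all brackets among \<open>X\<close>, \<open>Y\<close>,
    \<open>T\<close> vanish. These generate the image of B_n, since \<open>f\<close> is surjective,
    so the bracket would vanish on the whole image, contradicting
    \<open>[x, y] \<noteq> 0\<close>.\<close>
  have u_nz: "u \<noteq> 0"
  proof
    assume "u = 0"
    then have br0: "bracket X Y = 0" "bracket X T = 0" "bracket Y T = 0" using br by auto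
    then have br0': "bracket Y X = 0" "bracket T X = 0" "bracket T Y = 0"
      using bracket_commute[of Y X] bracket_commute[of T X] bracket_commute[of T Y] by simp_all
    have *: "bracket g (F b) = 0"
      if "bracket g X = 0" "bracket g Y = 0" "bracket g T = 0" "b \<in> Bring m" for g b
      using that(4)
      by (induction rule: Bring_induct)
        (use that(1-3) in \<open>simp_all add: F_scalar bracket_const_right F_add F_mult
          bracket_add_right bracket_mult_right flip: XYT\<close>)
    have "bracket X (F b) = 0" "bracket Y (F b) = 0" "bracket T (F b) = 0" if "b \<in> Bring m" for b
      using *[of X b] *[of Y b] *[of T b] br0 br0' that by (simp_all add: bracket_self)
    then have "bracket (F b) X = 0" "bracket (F b) Y = 0" "bracket (F b) T = 0" if "b \<in> Bring m" for b
      using that bracket_commute[of "F b" X] bracket_commute[of "F b" Y] bracket_commute[of "F b" T]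
      by simp_all
    then have "bracket (F a) (F b) = 0" if "a \<in> Bring m" "b \<in> Bring m" for a b
      using * that by simp
    then have "bracket r r' = 0" if "r \<in> laurent_ring n" "r' \<in> laurent_ring n" for r r' :: "'k laurent"
      using F_surj[OF that(1)] F_surj[OF that(2)] by auto
    from this[OF laurent_ring_gens(1,2)] show False
      by (simp add: bracket_gens_nonzero)
  qed
  \<comment> \<open>One factor \<open>X\<close> of \<open>X ^ Suc k\<close> stays beside
    \<open>T\<close>; the support bound for \<open>bracket X T\<close> then makes the remaining
    factor constant.\<close>
  have "- (u * X ^ k) * X * T = bracket X T" using br(2) by (simp add: mult_ac)
  then obtain e where e: "- (u * X ^ k) = Poly_Mapping.single 0 e"
    using keys_times_subset_imp_const[OF X_nz T_nz, of "- (u * X ^ k)"] keys_bracket[of X T] by metis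
  have e_nz: "e \<noteq> 0" using e u_nz X_nz by auto
  \<comment> \<open>Multiplying \<open>F w = - (h * u)\<close> by \<open>X ^ k\<close> leaves
    \<open>e\<close> times the image of \<open>x^(n-1)\<close>; injectivity brings this
    factorization back to B_n.\<close>
  have "laurent_of n (f w * f (embA varX) ^ k) = F (w * embA varX ^ k)"
    using w by (simp add: F_def mult f_power Bring_closed)
  also have "\<dots> = - (h * u) * X ^ k"
    using w by (simp add: F_mult F_power Bring_closed XYT)
  also have "\<dots> = h * Poly_Mapping.single 0 e" unfolding e[symmetric] by simp
  also have "\<dots> = laurent_of n (scalar e * embA varX ^ (n - 1))"
    by (simp add: h laurent_of_mult laurent_of_scalar laurent_of_power laurent_of_embA evalA_varX
        Bring_closed)
  finally have eq: "f w * f (embA varX) ^ k = scalar e * embA varX ^ (n - 1)"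
    by (rule laurent_of_inj[rotated 2]) (intro Bring_closed f_mem w)+
  \<comment> \<open>An inverse in B_n would pull back to an inverse of \<open>x\<close> in
    B_m.\<close>
  have nonunit: "f (embA varX) * v \<noteq> 1" if v: "v \<in> Bring n" for v
  proof
    assume *: "f (embA varX) * v = 1"
    obtain v' where v': "v' \<in> Bring m" "f v' = v" using f_surj[OF v] by blast
    then have "f (embA varX * v') = f 1" using * by (simp add: mult Bring_closed one)
    then have "embA varX * v' = 1" by (rule f_inj[rotated 2]) (intro Bring_closed v')+
    then show False using varX_not_unit[OF m v'(1), of 1] by (simp add: scalar_def flip: one_pCons)
  qed
  have "k \<le> n - 1"
    by (rule power_divides_varX_power_imp_le[OF n _ _ e_nz eq nonunit]) (intro f_mem w Bring_closed)+
  then show ?thesis using n k by simp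
qed

theorem theorem4p1:
  fixes m n :: nat and f :: "('k::field poly poly) fract \<Rightarrow> ('k poly poly) fract"
  assumes "m \<ge> 1" and "n \<ge> 1"
    and "k_alg_iso f (Bring m :: ('k poly poly) fract set) (Bring n)"
  shows "m = n"
  using k_alg_iso_imp_le[OF assms] k_alg_iso_imp_le[OF assms(2,1) k_alg_iso_inverse[OF assms(3)]]
  by simp

end
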